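(* Let $N, L \geq 1$ be integers and let $\{\mathbf{e}_l\}_{l=0}^{L-1}$ be a set of nonzero vectors in $\mathbb{C}^N$ such that $\|\mathbf{e}_l\| = (NL)^{-1/2}$ for all $l = 0,\ldots,L-1$. For $l = 0,\ldots,L-1$ and $k,m = 0,\ldots,N-1$ define $\mathbf{a}_{l,k,m} \in \mathbb{C}^N$ by \[ a_{l,k,m}[n] = e_l[n-m \bmod N]\,\exp\left(2\pi j k(n-m)/N\right), \qquad n = 0,\ldots,N-1. \] Then the vectors $\{\mathbf{a}_{l,k,m}\}$ form a Parseval frame, i.e. \[ \sum_{l=0}^{L-1}\sum_{k=0}^{N-1}\sum_{m=0}^{N-1} |\langle \mathbf{w}, \mathbf{a}_{l,k,m}\rangle|^2 = \|\mathbf{w}\|^2 \quad \text{for all } \mathbf{w}\in\mathbb{C}^N. \]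
   Context: $\mathbb{C}^N$ carries the standard complex inner product $\langle\cdot,\cdot\rangle$ and $\|\cdot\|$ is the $\ell_2$ norm. Vectors are indexed from $0$: $v[n]$ (non-bold) denotes the $n$-th entry of $\mathbf{v}$, $n = 0,\ldots,N-1$. Here $j$ is the imaginary unit and $n-m \bmod N$ denotes the representative in $\{0,\ldots,N-1\}$. A Parseval frame is a finite family (indexed, repetitions allowed) $\{\mathbf{a}_i\}_{i=0}^{K-1}$ in $\mathbb{C}^N$ with $\sum_{i=0}^{K-1} |\langle \mathbf{w},\mathbf{a}_i\rangle|^2 = \|\mathbf{w}\|^2$ for all $\mathbf{w}\in\mathbb{C}^N$. *)

theory Defs
  imports "HOL-Analysis.L2_Norm" "Jordan_Normal_Form.Matrix"
begin

text \<open>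
  Vectors in \<open>\<complex>\<^sup>N\<close> are elements of \<^term>\<open>carrier_vec N :: complex vec set\<close>, indexed from \<open>0\<close>.
  The inner product \<open>\<langle>v, w\<rangle>\<close> is \<open>v \<bullet>c w\<close>, linear in the first and conjugate-linear in the
  second argument.
\<close>

definition l2_norm :: "complex vec \<Rightarrow> real" where
  "l2_norm v = L2_set (\<lambda>n. cmod (v $ n)) {..<dim_vec v}"

definition parseval_frame :: "nat \<Rightarrow> 'i set \<Rightarrow> ('i \<Rightarrow> complex vec) \<Rightarrow> bool" where
  "parseval_frame N I a \<longleftrightarrow>
     finite I \<and> (\<forall>i\<in>I. a i \<in> carrier_vec N) \<and>
     (\<forall>w\<in>carrier_vec N. (\<Sum>i\<in>I. (cmod (w \<bullet>c a i))\<^sup>2) = (l2_norm w)\<^sup>2)"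

text \<open>
  The vector with entries \<open>v[n - m mod N] exp (2 \<pi> \<i> k (n - m) / N)\<close>. The differences are
  taken in \<^typ>\<open>int\<close>, as subtraction on \<^typ>\<open>nat\<close> truncates; the one in the exponential is
  not reduced modulo \<open>N\<close>.
\<close>
definition time_freq_shift :: "nat \<Rightarrow> complex vec \<Rightarrow> nat \<Rightarrow> nat \<Rightarrow> complex vec" where
  "time_freq_shift N v k m =
     vec N (\<lambda>n. v $ nat ((int n - int m) mod int N) *
                exp (2 * of_real pi * \<i> * of_nat k * of_int (int n - int m) / of_nat N))"

end

theory Submission
  imports Defs
begin

text \<open>
  For a fixed shift \<open>m\<close>, the inner products with the \<open>N\<close> modulations are, up to phases, the
  discrete Fourier coefficients of the pointwise product of \<open>w\<close> with the conjugate of the shifted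
  window, so Parseval's identity gives \<open>N (\<Sum>n. |w[n]|\<^sup>2 |e\<^sub>l[n - m]|\<^sup>2)\<close>. Summing over all cyclic
  shifts decouples the two factors and leaves \<open>N \<parallel>w\<parallel>\<^sup>2 \<parallel>e\<^sub>l\<parallel>\<^sup>2 = \<parallel>w\<parallel>\<^sup>2 / L\<close>.
\<close>

text \<open>A geometric sum in the \<open>N\<close>-th root of unity \<open>z\<close> with angle
  \<open>2 * pi * d / N\<close>. Within the bound, \<open>0\<close> is the only multiple of
  \<open>N\<close>, so \<open>z \<noteq> 1\<close> whenever \<open>d \<noteq> 0\<close>.\<close>

lemma sum_roots_of_unity_characters:
  fixes d :: int
  assumes "\<bar>d\<bar> < int N"
  shows "(\<Sum>k<N. exp (2 * of_real pi * \<i> * of_nat k * of_int d / of_nat N)) =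
           (if d = 0 then of_nat N else (0 :: complex))"
proof (cases "d = 0")
  case False
  define z :: complex where "z = exp (2 * of_real pi * \<i> * of_int d / of_nat N)"
  have N: "N > 0"
    using assms by linarith
  have "z \<noteq> 1"
  proof
    assume "z = 1"
    \<comment> \<open>The real part suffices: a cosine equal to 1 forces the angle to be a multiple
      of \<open>2 * pi\<close>, hence \<open>N\<close> divides \<open>d\<close>.\<close>
    have "cos (2 * pi * real_of_int d / real N) = Re z"
      by (simp add: z_def Re_exp)
    with \<open>z = 1\<close> obtain q :: int where "2 * pi * real_of_int d / real N = of_int q * 2 * pi"
      by (auto simp: cos_one_2pi_int)
    then have "real_of_int d = of_int (q * int N)"
      using N by (simp add: field_simps)
    then have "d = q * int N"
      by (simp only: of_int_eq_iff)
    then have "int N dvd d"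
      by simp
    then show False
      using dvd_imp_le_int [OF False] assms by force
  qed
  moreover have "z ^ N = 1"
  proof -
    have "z ^ N = cis (2 * pi * of_int d)"
      unfolding z_def exp_of_nat_mult [symmetric] cis_conv_exp using N by (simp add: mult_ac)
    also have "\<dots> = 1"
      by (rule cis_multiple_2pi) simp
    finally show ?thesis .
  qed
  ultimately have "(\<Sum>k<N. z ^ k) = 0"
    by (simp add: sum_gp_strict)
  moreover have "exp (2 * of_real pi * \<i> * of_nat k * of_int d / of_nat N) = z ^ k" for k
    unfolding z_def exp_of_nat_mult [symmetric] by (simp add: mult_ac)
  ultimately show ?thesis
    using False by simp
qed simp

text \<open>Expanding the squared modulus gives a double sum over \<open>n\<close> and
  \<open>p\<close>, of which orthogonality of the characters leaves the diagonal. The offset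
  \<open>s\<close> accommodates the unreduced exponent \<open>n - m\<close>; it only contributes a
  phase common to all \<open>n\<close>, which cancels in \<open>E\<close>.\<close>

lemma discrete_Fourier_Parseval:
  fixes c :: "nat \<Rightarrow> complex" and s :: int
  shows "(\<Sum>k<N. (cmod (\<Sum>n<N. c n *
            cnj (exp (2 * of_real pi * \<i> * of_nat k * of_int (int n - s) / of_nat N))))\<^sup>2)
         = real N * (\<Sum>n<N. (cmod (c n))\<^sup>2)"
proof -
  define E :: "nat \<Rightarrow> int \<Rightarrow> complex"
    where "E k d = exp (2 * of_real pi * \<i> * of_nat k * of_int d / of_nat N)" for k d
  have E: "cnj (E k (int n - s)) * E k (int p - s) = E k (int p - int n)" for k n p
  proof -
    have cis: "E k d = cis (2 * pi * real k * of_int d / real N)" for d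
      by (simp add: E_def cis_conv_exp mult_ac)
    show ?thesis
      unfolding cis cis_cnj cis_mult
      by (rule arg_cong [where f = cis]) (simp add: diff_divide_distrib algebra_simps)
  qed
  \<comment> \<open>Over the complex numbers a squared modulus is a product with the conjugate,
    which can be multiplied out.\<close>
  have "complex_of_real (\<Sum>k<N. (cmod (\<Sum>n<N. c n * cnj (E k (int n - s))))\<^sup>2)
      = (\<Sum>k<N. \<Sum>n<N. \<Sum>p<N. c n * cnj (c p) * (cnj (E k (int n - s)) * E k (int p - s)))"
    by (simp only: of_real_sum complex_norm_square cnj_sum sum_product complex_cnj_mult
        complex_cnj_cnj mult_ac)
  also have "\<dots> = (\<Sum>k<N. \<Sum>n<N. \<Sum>p<N. c n * cnj (c p) * E k (int p - int n))"
    by (simp only: E)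
  also have "\<dots> = (\<Sum>n<N. \<Sum>k<N. \<Sum>p<N. c n * cnj (c p) * E k (int p - int n))"
    by (rule sum.swap)
  also have "\<dots> = (\<Sum>n<N. \<Sum>p<N. \<Sum>k<N. c n * cnj (c p) * E k (int p - int n))"
    by (rule sum.cong [OF refl sum.swap])
  also have "\<dots> = (\<Sum>n<N. \<Sum>p<N. if p = n then of_nat N * (c n * cnj (c n)) else 0)"
  proof (intro sum.cong refl)
    fix n p assume "n \<in> {..<N}" "p \<in> {..<N}"
    \<comment> \<open>Two indices below \<open>N\<close> differ by less than \<open>N\<close> in
      absolute value, as the character sum requires.\<close>
    then have "(\<Sum>k<N. E k (int p - int n)) = (if int p - int n = 0 then of_nat N else 0)"
      unfolding E_def by (intro sum_roots_of_unity_characters) auto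
    then show "(\<Sum>k<N. c n * cnj (c p) * E k (int p - int n))
        = (if p = n then of_nat N * (c n * cnj (c n)) else 0)"
      by (simp add: sum_distrib_left [symmetric])
  qed
  also have "\<dots> = complex_of_real (real N * (\<Sum>n<N. (cmod (c n))\<^sup>2))"
    by (simp add: sum_distrib_left complex_norm_square del: of_real_power)
  finally show ?thesis
    unfolding E_def of_real_eq_iff .
qed

text \<open>Reflection \<open>m \<mapsto> (n - m) mod N\<close> is an involution of the residues, so
  the terms are only permuted and \<open>r\<close> is its own inverse in the reindexing.\<close>

lemma sum_cyclic_reflection:
  fixes f :: "nat \<Rightarrow> 'a :: comm_monoid_add"
  assumes "n < N"
  shows "(\<Sum>m<N. f (nat ((int n - int m) mod int N))) = (\<Sum>m<N. f m)"
proof -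
  define r where "r m = nat ((int n - int m) mod int N)" for m
  have "r m < N" for m
    using assms by (simp add: r_def nat_less_iff)
  moreover have "r (r m) = m" if "m < N" for m
  proof -
    have "int (r m) = (int n - int m) mod int N"
      using assms by (simp add: r_def)
    then have "(int n - int (r m)) mod int N = int m mod int N"
      by (simp add: mod_diff_right_eq)
    then show ?thesis
      using that by (simp add: r_def [of "r m"])
  qed
  ultimately have "(\<Sum>m<N. f (r m)) = (\<Sum>m<N. f m)"
    by (intro sum.reindex_bij_witness [of _ r r]) auto
  then show ?thesis
    by (simp add: r_def)
qed

lemma l2_norm_squared:
  "v \<in> carrier_vec N \<Longrightarrow> (l2_norm v)\<^sup>2 = (\<Sum>n<N. (cmod (v $ n))\<^sup>2)"
  by (auto simp: l2_norm_def L2_set_def sum_nonneg)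

text \<open>For a nonzero window \<open>v\<close> this is the tight frame identity with bound
  \<open>N\<close> times the squared norm of \<open>v\<close>.\<close>

lemma sum_time_freq_shift_coefficients:
  assumes w: "w \<in> carrier_vec N" and v: "v \<in> carrier_vec N"
  shows "(\<Sum>k<N. \<Sum>m<N. (cmod (w \<bullet>c time_freq_shift N v k m))\<^sup>2)
         = real N * (l2_norm w)\<^sup>2 * (l2_norm v)\<^sup>2"
proof -
  define r where "r n m = nat ((int n - int m) mod int N)" for n m
  \<comment> \<open>The bracketing isolates a coefficient independent of \<open>k\<close>; keeping
    \<open>of_int (int n - int m)\<close> unsplit matches the Fourier identity with
    \<open>s = int m\<close>.\<close>
  have inner: "w \<bullet>c time_freq_shift N v k m = (\<Sum>n<N. w $ n * cnj (v $ r n m) *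
      cnj (exp (2 * of_real pi * \<i> * of_nat k * of_int (int n - int m) / of_nat N)))" for k m
    by (simp add: scalar_prod_def time_freq_shift_def r_def lessThan_atLeast0 mult.assoc
        del: of_int_diff)
  have "(\<Sum>k<N. \<Sum>m<N. (cmod (w \<bullet>c time_freq_shift N v k m))\<^sup>2)
      = (\<Sum>m<N. \<Sum>k<N. (cmod (w \<bullet>c time_freq_shift N v k m))\<^sup>2)"
    by (rule sum.swap)
  also have "\<dots> = (\<Sum>m<N. real N * (\<Sum>n<N. (cmod (w $ n * cnj (v $ r n m)))\<^sup>2))"
    by (simp only: inner discrete_Fourier_Parseval)
  also have "\<dots> = real N * (\<Sum>m<N. \<Sum>n<N. (cmod (w $ n))\<^sup>2 * (cmod (v $ r n m))\<^sup>2)"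
    by (simp add: norm_mult power_mult_distrib sum_distrib_left)
  \<comment> \<open>With \<open>n\<close> fixed, \<open>r n m\<close> runs through all indices as
    \<open>m\<close> does, so the inner sum no longer depends on \<open>n\<close>.\<close>
  also have "\<dots> = real N * (\<Sum>n<N. \<Sum>m<N. (cmod (w $ n))\<^sup>2 * (cmod (v $ r n m))\<^sup>2)"
    by (subst sum.swap) (rule refl)
  also have "\<dots> = real N * (\<Sum>n<N. (cmod (w $ n))\<^sup>2 * (\<Sum>m<N. (cmod (v $ m))\<^sup>2))"
    by (simp add: r_def sum_distrib_left [symmetric]
        sum_cyclic_reflection [where f = "\<lambda>m. (cmod (v $ m))\<^sup>2"])
  finally show ?thesis
    by (simp add: l2_norm_squared [OF w] l2_norm_squared [OF v] sum_distrib_right)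
qed

theorem corollary1:
  fixes N L :: nat
    and e :: "nat \<Rightarrow> complex vec"
    and a :: "nat \<Rightarrow> nat \<Rightarrow> nat \<Rightarrow> complex vec"
  assumes "N \<ge> 1" and "L \<ge> 1"
    and "\<And>l. l < L \<Longrightarrow> e l \<in> carrier_vec N"
    and "\<And>l. l < L \<Longrightarrow> e l \<noteq> 0\<^sub>v N"
    and "\<And>l. l < L \<Longrightarrow> l2_norm (e l) = (real N * real L) powr (- 1 / 2)"
    and "\<And>l k m. l < L \<Longrightarrow> k < N \<Longrightarrow> m < N \<Longrightarrow> a l k m = time_freq_shift N (e l) k m"
  shows "parseval_frame N ({..<L} \<times> {..<N} \<times> {..<N}) (\<lambda>(l, k, m). a l k m) \<and>
    (\<forall>w\<in>carrier_vec N.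
       (\<Sum>l<L. \<Sum>k<N. \<Sum>m<N. (cmod (w \<bullet>c a l k m))\<^sup>2) = (l2_norm w)\<^sup>2)"
proof -
  have sums: "(\<Sum>l<L. \<Sum>k<N. \<Sum>m<N. (cmod (w \<bullet>c a l k m))\<^sup>2) = (l2_norm w)\<^sup>2"
    if w: "w \<in> carrier_vec N" for w
  proof -
    \<comment> \<open>The squared window norm \<open>1 / (N * L)\<close> cancels the factor
      \<open>N\<close>, so the \<open>L\<close> windows contribute equal shares.\<close>
    have "(\<Sum>k<N. \<Sum>m<N. (cmod (w \<bullet>c a l k m))\<^sup>2) = (l2_norm w)\<^sup>2 / real L" if "l < L" for l
    proof -
      have "(l2_norm (e l))\<^sup>2 = (real N * real L) powr (- 1)"
        unfolding assms(5) [OF that] using assms(1,2) by (simp add: powr_power)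
      also have "\<dots> = 1 / (real N * real L)"
        using assms(1,2) by (simp add: powr_minus_divide)
      finally have norm: "(l2_norm (e l))\<^sup>2 = 1 / (real N * real L)" .
      have "(\<Sum>k<N. \<Sum>m<N. (cmod (w \<bullet>c a l k m))\<^sup>2)
          = (\<Sum>k<N. \<Sum>m<N. (cmod (w \<bullet>c time_freq_shift N (e l) k m))\<^sup>2)"
        using that assms(6) by simp
      also have "\<dots> = real N * (l2_norm w)\<^sup>2 * (l2_norm (e l))\<^sup>2"
        using w assms(3) [OF that] by (rule sum_time_freq_shift_coefficients)
      finally show ?thesis
        using assms(1) norm by simp
    qed
    then show ?thesis
      using assms(2) by simp
  qed
  moreover have "a l k m \<in> carrier_vec N" if "l < L" "k < N" "m < N" for l k m
    using that by (simp add: assms(6) time_freq_shift_def)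
  \<comment> \<open>The sum over index triples unfolds into the iterated sum already
    evaluated.\<close>
  ultimately show ?thesis
    by (auto simp: parseval_frame_def sum.cartesian_product' case_prod_unfold)
qed

end
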